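(* Let $0 < A \le B$ be fixed real numbers. For each integer $d \ge 1$, let $x_d$ be the unique number satisfying $0 < x_d \le 1/4$ and $D_d(x_d) = \frac{A}{B}$. Then $$\lim_{d\to\infty} \frac{x_d - \frac{1}{\pi d}\ln\big(1+\frac{A}{B}\big)}{\dfrac{\big[\ln\big(1+\frac{A}{B}\big)\big]^2}{6\pi\big(1+\frac{B}{A}\big)d^2}} = 1.$$
   Context: For an integer $d \ge 1$ and $0 < x \le 1/4$, define $$D_d(x) := \Big(1-\cos \pi x+\sin \pi x+\frac{\sin \pi x}{\pi x}\Big)^d - \Big(\frac{\sin \pi x}{\pi x}\Big)^d.$$ *)

theory Defs
  imports Complex_Main
begin

definition D :: "nat \<Rightarrow> real \<Rightarrow> real" where
  "D d x = (1 - cos (pi * x) + sin (pi * x) + sin (pi * x) / (pi * x)) ^ d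
           - (sin (pi * x) / (pi * x)) ^ d"

definition is_sol :: "real \<Rightarrow> real \<Rightarrow> nat \<Rightarrow> real \<Rightarrow> bool" where
  "is_sol A B d x \<longleftrightarrow> 0 < x \<and> x \<le> 1 / 4 \<and> D d x = A / B"

definition sol :: "real \<Rightarrow> real \<Rightarrow> nat \<Rightarrow> real" where
  "sol A B d = (THE x. is_sol A B d x)"

end

theory Submission
  imports Defs "HOL-Real_Asymp.Real_Asymp"
begin

text \<open>
  Put \<open>t = \<pi> x\<close>, \<open>s = sin t / t\<close> and \<open>g = 1 - cos t + sin t + s\<close>, so that
  \<open>D d x = g ^ d - s ^ d\<close>, and let \<open>r = A / B\<close>, \<open>L = ln (1 + r)\<close>.

  For \<open>0 < t < 1\<close> the base \<open>g\<close> increases and \<open>s\<close> decreases, so \<open>D d\<close> is strictly increasing on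
  the interval of interest. It tends to \<open>0\<close> at the left end; at \<open>x = 1/4\<close> one has \<open>g = 1 + s\<close>,
  hence \<open>D d (1/4) \<ge> 1 \<ge> r\<close>. This gives existence and uniqueness of the solution
  (lemmas \<open>D_strict_mono\<close> and \<open>ex1_is_sol\<close>).

  For the asymptotics, \<open>ln g = t - t\<^sup>2/6 + O(t\<^sup>3)\<close> and \<open>ln s = - t\<^sup>2/6 + O(t\<^sup>4)\<close>. At the trial
  point \<open>t = L/d + k/d\<^sup>2\<close> this yields
  \<open>D d x = r + ((1 + r) (k - L\<^sup>2/6) + L\<^sup>2/6) / d + o(1/d)\<close> (lemma \<open>D_expansion\<close>). The coefficient of
  \<open>1/d\<close> is increasing in \<open>k\<close> and vanishes exactly at \<open>k = c\<close> with \<open>c = L\<^sup>2 / (6 (1 + 1/r))\<close>.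
  So for every \<open>e > 0\<close> and large \<open>d\<close> the trial points with \<open>k = (1 - e) c\<close> and \<open>k = (1 + e) c\<close> have
  values of \<open>D d\<close> below and above \<open>r\<close>; by monotonicity they enclose the solution, which
  is the claimed limit.
\<close>

lemma one_minus_less_cos:
  fixes t :: real
  assumes "0 < t" "t < 1"
  shows "1 - t < cos t"
proof -
  have "\<bar>sin (t / 2)\<bar> \<le> \<bar>t / 2\<bar>" by (rule abs_sin_x_le_abs_x)
  hence "(sin (t / 2))\<^sup>2 \<le> (t / 2)\<^sup>2" by (simp only: abs_le_square_iff)
  moreover have "cos t = 1 - 2 * (sin (t / 2))\<^sup>2"
    using cos_double_sin[of "t / 2"] by simp
  moreover have "t * t < t * 1" using assms by (intro mult_strict_left_mono) auto
  moreover have "(t / 2)\<^sup>2 = t * t / 4" by (simp add: power2_eq_square)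
  ultimately show ?thesis using assms by linarith
qed

lemma mult_cos_less_sin:
  fixes t :: real
  assumes "0 < t" "t < pi"
  shows "t * cos t < sin t"
proof -
  have "(\<lambda>u. sin u - u * cos u) 0 < (\<lambda>u. sin u - u * cos u) t"
  proof (rule DERIV_pos_imp_increasing_open[OF \<open>0 < t\<close>])
    fix u :: real assume u: "0 < u" "u < t"
    have "((\<lambda>u. sin u - u * cos u) has_real_derivative u * sin u) (at u)"
      by (auto intro!: derivative_eq_intros)
    moreover have "0 < u * sin u" using u assms by (simp add: sin_gt_zero)
    ultimately show "\<exists>y. ((\<lambda>u. sin u - u * cos u) has_real_derivative y) (at u) \<and> 0 < y"
      by blast
  qed (intro continuous_intros)
  thus ?thesis by simp
qed

lemma sinc_has_derivative:
  fixes t :: real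
  assumes "t \<noteq> 0"
  shows "((\<lambda>u. sin u / u) has_real_derivative (t * cos t - sin t) / t\<^sup>2) (at t)"
  using assms by (auto intro!: derivative_eq_intros simp: power2_eq_square algebra_simps)

lemma sinc_strict_decreasing:
  fixes a b :: real
  assumes "0 < a" "a < b" "b < pi"
  shows "sin b / b < sin a / a"
proof (rule DERIV_neg_imp_decreasing[OF \<open>a < b\<close>])
  fix t :: real assume "a \<le> t" "t \<le> b"
  hence "0 < t" "t < pi" using assms by auto
  thus "\<exists>y. ((\<lambda>t. sin t / t) has_real_derivative y) (at t) \<and> y < 0"
    using sinc_has_derivative[of t] mult_cos_less_sin[of t]
    by (intro exI[of _ "(t * cos t - sin t) / t\<^sup>2"]) (auto simp: divide_neg_pos)
qed

text \<open>
  The derivative is \<open>sin t + cos t - (sin t - t cos t) / t\<^sup>2\<close>, whose sign is that of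
  \<open>(1 + t) (t cos t - (1 - t) sin t)\<close>. This is positive because \<open>sin t \<le> t\<close> and
  \<open>1 - t < cos t\<close>.
\<close>
lemma larger_base_strict_increasing:
  fixes a b :: real
  assumes "0 < a" "a < b" "b < 1"
  shows "1 - cos a + sin a + sin a / a < 1 - cos b + sin b + sin b / b"
proof (rule DERIV_pos_imp_increasing[OF \<open>a < b\<close>])
  fix t :: real assume "a \<le> t" "t \<le> b"
  hence t: "0 < t" "t < 1" using assms by auto
  define y where "y = sin t + cos t + (t * cos t - sin t) / t\<^sup>2"
  have "(1 - t) * sin t \<le> (1 - t) * t"
    using t by (intro mult_left_mono sin_x_le_x) auto
  also have "\<dots> < cos t * t"
    using t one_minus_less_cos[OF t] by (intro mult_strict_right_mono) auto
  finally have "0 < (1 + t) * (t * cos t - (1 - t) * sin t)"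
    using t by (intro mult_pos_pos) (auto simp: mult.commute)
  also have "\<dots> = y * t\<^sup>2"
    using t by (simp add: y_def power2_eq_square field_simps)
  finally have "0 < y" using t by (simp add: zero_less_mult_iff)
  moreover have "((\<lambda>t. 1 - cos t + sin t + sin t / t) has_real_derivative y) (at t)"
    unfolding y_def using t
    by (auto intro!: derivative_eq_intros simp: power2_eq_square algebra_simps)
  ultimately show "\<exists>y. ((\<lambda>t. 1 - cos t + sin t + sin t / t) has_real_derivative y) (at t) \<and> 0 < y"
    by blast
qed

lemma sinc_pos:
  fixes t :: real
  assumes "0 < t" "t < pi"
  shows "0 < sin t / t"
  using assms by (simp add: sin_gt_zero)

lemma larger_base_pos:
  fixes t :: real
  assumes "0 < t" "t < pi"
  shows "0 < 1 - cos t + sin t + sin t / t"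
  using sinc_pos[OF assms] sin_gt_zero[OF assms] cos_le_one[of t] by linarith

lemma D_strict_mono:
  fixes x y :: real
  assumes "1 \<le> d" "0 < x" "x < y" "y \<le> 1 / 4"
  shows "D d x < D d y"
proof -
  have x: "0 < pi * x" "pi * x < pi * y"
    using assms by auto
  have "pi * y \<le> pi * (1 / 4)" using assms by (intro mult_left_mono) auto
  hence y: "pi * y < 1" "pi * y < pi" using pi_less_4 pi_gt_zero by linarith+
  have "(sin (pi * y) / (pi * y)) ^ d \<le> (sin (pi * x) / (pi * x)) ^ d"
    using sinc_strict_decreasing[OF x y(2)] sinc_pos[of "pi * y"] x y
    by (intro power_mono) auto
  moreover have "(1 - cos (pi * x) + sin (pi * x) + sin (pi * x) / (pi * x)) ^ d
      < (1 - cos (pi * y) + sin (pi * y) + sin (pi * y) / (pi * y)) ^ d"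
    using larger_base_strict_increasing[OF x y(1)] larger_base_pos[of "pi * x"] x y assms(1)
    by (intro power_strict_mono) auto
  ultimately show ?thesis by (simp add: D_def)
qed

lemma D_tendsto_0: "(D d \<longlongrightarrow> 0) (at_right 0)"
proof -
  have "((\<lambda>x::real. 1 - cos (pi * x) + sin (pi * x) + sin (pi * x) / (pi * x)) \<longlongrightarrow> 1) (at_right 0)"
    by real_asymp
  moreover have "((\<lambda>x::real. sin (pi * x) / (pi * x)) \<longlongrightarrow> 1) (at_right 0)"
    by real_asymp
  ultimately have "(D d \<longlongrightarrow> 1 ^ d - 1 ^ d) (at_right 0)"
    unfolding D_def by (intro tendsto_intros)
  thus ?thesis by simp
qed

lemma one_plus_power_le_power_one_plus:
  fixes s :: real
  assumes "0 \<le> s" "1 \<le> d"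
  shows "1 + s ^ d \<le> (1 + s) ^ d"
  using \<open>1 \<le> d\<close>
proof (induction d rule: dec_induct)
  case (step n)
  have "1 + s ^ Suc n \<le> (1 + s) * (1 + s ^ n)"
    using assms by (simp add: algebra_simps)
  also have "\<dots> \<le> (1 + s) * (1 + s) ^ n"
    using step assms by (intro mult_left_mono) auto
  finally show ?case by simp
qed simp

lemma D_quarter_ge_1:
  assumes "1 \<le> d"
  shows "1 \<le> D d (1 / 4)"
proof -
  have "0 \<le> sin (pi / 4) / (pi / 4)" using sinc_pos[of "pi / 4"] by simp
  from one_plus_power_le_power_one_plus[OF this assms] show ?thesis
    by (simp add: D_def cos_45 sin_45)
qed

lemma ex1_is_sol:
  assumes "0 < A" "A \<le> B" "1 \<le> d"
  shows "\<exists>!x. is_sol A B d x"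
proof -
  have r: "0 < A / B" "A / B \<le> 1" using assms by auto
  have "eventually (\<lambda>x. D d x < A / B \<and> x \<in> {0<..<1/4}) (at_right 0)"
    using order_tendstoD(2)[OF D_tendsto_0 r(1)]
    by (intro eventually_conj eventually_at_right_real) auto
  then obtain a where a: "D d a < A / B" "0 < a" "a < 1 / 4"
    using eventually_happens' by (metis (mono_tags, lifting) greaterThanLessThan_iff
        trivial_limit_at_right_real)
  have "continuous_on {a..1/4} (D d)"
    unfolding D_def using a by (intro continuous_intros) auto
  then obtain x where "a \<le> x" "x \<le> 1 / 4" "D d x = A / B"
    using IVT'[of "D d" a "A / B" "1 / 4"] a r D_quarter_ge_1[OF assms(3)] by auto
  hence "is_sol A B d x" using a by (simp add: is_sol_def)
  moreover have "x = y" if "is_sol A B d x" "is_sol A B d y" for x y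
    using that D_strict_mono[OF assms(3), of x y] D_strict_mono[OF assms(3), of y x]
    by (cases x y rule: linorder_cases) (auto simp: is_sol_def)
  ultimately show ?thesis by blast
qed

lemma is_sol_sol:
  assumes "0 < A" "A \<le> B" "1 \<le> d"
  shows "is_sol A B d (sol A B d)"
  unfolding sol_def using ex1_is_sol[OF assms] by (rule theI')

text \<open>
  Writing the powers as \<open>exp (n ln \<dots>)\<close> with a real exponent \<open>n\<close> turns the claim into a limit of
  an elementary function, to which automatic multiseries expansion applies.
\<close>
lemma D_expansion:
  fixes L k :: real
  assumes "0 < L"
  shows "(\<lambda>d. real d * (D d ((L / real d + k / (real d)\<^sup>2) / pi) - (exp L - 1)))
           \<longlonglongrightarrow> exp L * (k - L\<^sup>2 / 6) + L\<^sup>2 / 6"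
proof -
  let ?t = "\<lambda>n::real. L / n + k / n\<^sup>2"
  let ?F = "\<lambda>n::real. n * (exp (n * ln (1 - cos (?t n) + sin (?t n) + sin (?t n) / ?t n))
              - exp (n * ln (sin (?t n) / ?t n)) - (exp L - 1))"
  have "(?F \<longlongrightarrow> exp L * (k - L\<^sup>2 / 6) + L\<^sup>2 / 6) at_top"
    using assms by real_asymp (simp add: field_simps power2_eq_square)
  hence lim: "(\<lambda>d. ?F (real d)) \<longlonglongrightarrow> exp L * (k - L\<^sup>2 / 6) + L\<^sup>2 / 6"
    by (rule filterlim_compose[OF _ filterlim_real_sequentially])
  have "eventually (\<lambda>n. 0 < ?t n) at_top" using assms by real_asymp
  moreover have "eventually (\<lambda>n. ?t n < pi) at_top" by real_asymp
  ultimately have "eventually (\<lambda>n. 0 < ?t n \<and> ?t n < pi) at_top" by (rule eventually_conj)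
  hence "eventually (\<lambda>d. 0 < ?t (real d) \<and> ?t (real d) < pi) sequentially"
    using filterlim_real_sequentially by (rule eventually_compose_filterlim)
  hence "eventually (\<lambda>d. ?F (real d) =
           real d * (D d (?t (real d) / pi) - (exp L - 1))) sequentially"
  proof eventually_elim
    case (elim d)
    have "exp (real d * ln b) = b ^ d" if "0 < b" for b :: real
      using that by (simp add: exp_of_nat_mult)
    with elim show ?case
      using sinc_pos[of "?t (real d)"] larger_base_pos[of "?t (real d)"] by (simp add: D_def)
  qed
  thus ?thesis using lim by (rule Lim_transform_eventually[rotated])
qed

theorem theorem4:
  fixes A B :: real
  assumes "0 < A" and "A \<le> B"
  shows "(\<forall>d\<ge>1. \<exists>!x. is_sol A B d x) \<and>
    (\<lambda>d. (sol A B d - 1 / (pi * real d) * ln (1 + A / B)) /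
          ((ln (1 + A / B))\<^sup>2 / (6 * pi * (1 + B / A) * (real d)\<^sup>2)))
      \<longlonglongrightarrow> 1"
proof
  show "\<forall>d\<ge>1. \<exists>!x. is_sol A B d x" using ex1_is_sol[OF assms] by blast
next
  define r where "r = A / B"
  define L where "L = ln (1 + r)"
  define c where "c = L\<^sup>2 / (6 * (1 + B / A))"
  have r: "0 < r" using assms by (simp add: r_def)
  have L: "0 < L" "exp L = 1 + r" using r by (auto simp: L_def)
  have c: "0 < c" using L assms by (simp add: c_def add_pos_pos)
  \<comment> \<open>\<open>c\<close> is the value of \<open>k\<close> at which the first-order coefficient in \<open>D_expansion\<close> vanishes.\<close>
  have root: "(1 + r) * (c - L\<^sup>2 / 6) + L\<^sup>2 / 6 = 0"
    using assms by (simp add: c_def r_def divide_simps add_pos_pos) (simp add: algebra_simps)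
  define x where "x = (\<lambda>k d. (L / real d + k / (real d)\<^sup>2) / pi)"
  have lim: "(\<lambda>d. real d * (D d (x k d) - r)) \<longlonglongrightarrow> (1 + r) * (k - c)" for k
  proof -
    have "exp L * (k - L\<^sup>2 / 6) + L\<^sup>2 / 6 = (1 + r) * (k - c)"
      using root L by (simp add: algebra_simps)
    with D_expansion[OF L(1), of k] L(2) show ?thesis by (simp add: x_def)
  qed
  have x_pos: "eventually (\<lambda>d. 0 < x k d) sequentially"
    and x_le: "eventually (\<lambda>d. x k d \<le> 1 / 4) sequentially" for k
    unfolding x_def using L(1) by real_asymp+
  show "(\<lambda>d. (sol A B d - 1 / (pi * real d) * ln (1 + A / B)) /
          ((ln (1 + A / B))\<^sup>2 / (6 * pi * (1 + B / A) * (real d)\<^sup>2))) \<longlonglongrightarrow> 1"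
  proof (rule tendstoI)
    fix e :: real assume e: "0 < e"
    define lo where "lo = c * (1 - e)"
    define hi where "hi = c * (1 + e)"
    have "(1 + r) * (lo - c) < 0" "0 < (1 + r) * (hi - c)"
      using r c e
      by (auto simp: lo_def hi_def mult_less_0_iff zero_less_mult_iff mult_less_cancel_left1 mult_less_cancel_left2)
    from order_tendstoD(2)[OF lim this(1)] order_tendstoD(1)[OF lim this(2)]
      x_pos[of lo] x_pos[of hi] x_le[of lo] x_le[of hi] eventually_ge_at_top[of 1]
    show "eventually (\<lambda>d. dist ((sol A B d - 1 / (pi * real d) * ln (1 + A / B)) /
          ((ln (1 + A / B))\<^sup>2 / (6 * pi * (1 + B / A) * (real d)\<^sup>2))) 1 < e) sequentially"
    proof eventually_elim
      case (elim d)
      have d: "0 < real d" using elim by simp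
      have sol: "0 < sol A B d" "sol A B d \<le> 1 / 4" "D d (sol A B d) = r"
        using is_sol_sol[OF assms elim(7)] by (auto simp: is_sol_def r_def)
      have D: "D d (x lo d) < r" "r < D d (x hi d)"
        using elim(1,2) d by (auto simp: mult_less_0_iff zero_less_mult_iff)
      have lo: "x lo d < sol A B d"
      proof (rule ccontr)
        assume "\<not> x lo d < sol A B d"
        thus False using D_strict_mono[of d "sol A B d" "x lo d"] sol D elim
          by (cases "sol A B d = x lo d") auto
      qed
      have hi: "sol A B d < x hi d"
      proof (rule ccontr)
        assume "\<not> sol A B d < x hi d"
        thus False using D_strict_mono[of d "x hi d" "sol A B d"] sol D elim
          by (cases "sol A B d = x hi d") auto
      qed
      define q where "q = c / (pi * (real d)\<^sup>2)"
      have q: "0 < q" using c d by (simp add: q_def)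
      have x_eq: "x (c * u) d = L / (pi * real d) + u * q" for u
        by (simp add: x_def q_def add_divide_distrib mult.commute)
      have "1 - e < (sol A B d - L / (pi * real d)) / q"
           "(sol A B d - L / (pi * real d)) / q < 1 + e"
        using lo[unfolded lo_def x_eq] hi[unfolded hi_def x_eq] q by (simp_all add: field_simps)
      moreover have "(sol A B d - 1 / (pi * real d) * ln (1 + A / B)) /
          ((ln (1 + A / B))\<^sup>2 / (6 * pi * (1 + B / A) * (real d)\<^sup>2))
          = (sol A B d - L / (pi * real d)) / q"
        by (simp add: q_def c_def L_def r_def mult_ac)
      ultimately show ?case by (simp add: dist_real_def abs_less_iff)
    qed
  qed
qed

end
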